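(* Put $$A_q=\begin{pmatrix} q+1 & q^{-1}\\ 1 & q^{-1}\end{pmatrix},\qquad B_q=\begin{pmatrix} \frac{q^3+q^2+2q+1}{q} & \frac{q+1}{q^2}\\ \frac{q+1}{q} & q^{-2}\end{pmatrix}\in SL(2,\mathbb{Z}[q,q^{-1}]).$$ For every triple of Christoffel $ab$-words $(w,ww',w')$, the triple $$(x,y,z)=\left(\frac{\mathrm{Tr}\,w(A_q,B_q)}{[3]_q},\ \frac{\mathrm{Tr}\big(w(A_q,B_q)\,w'(A_q,B_q)\big)}{[3]_q},\ \frac{\mathrm{Tr}\,w'(A_q,B_q)}{[3]_q}\right)$$ belongs to $\mathbb{Z}[q,q^{-1}]^3$ and is a solution of $$x^2+y^2+z^2+\frac{(q-1)^2}{q^3}=[3]_q\,xyz .$$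
   Context: $q$ is a formal parameter and $[3]_q=1+q+q^2$. Triples of Christoffel $ab$-words are the triples of words in the letters $a,b$ generated as follows: $(a,ab,b)$ is such a triple, and whenever $(w,ww',w')$ is such a triple (where $ww'$ is the concatenation of $w$ and $w'$), so are $(w,\,www',\,ww')$ and $(ww',\,ww'w',\,w')$; all triples arise this way. For a word $w=w(a,b)$, $w(A_q,B_q)$ denotes the matrix product obtained by substituting $A_q$ for $a$ and $B_q$ for $b$ in the word, in the same order. *)

theory Defs
  imports
    "HOL-Analysis.Determinants"
    "HOL-Computational_Algebra.Polynomial_Factorial"
begin

text \<open>
  Everything is computed in the field \<open>\<rat>(q)\<close>, the fraction field of the polynomial ring
  \<open>\<int>[q]\<close>; the ring \<open>\<int>[q, q\<inverse>]\<close> is the subset \<open>laurent_polys\<close> of it.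
\<close>

type_synonym ratfun = "int poly fract"

definition q :: ratfun where
  "q = to_fract (monom 1 1)"

definition q3 :: ratfun  (\<open>[3]\<^sub>q\<close>) where
  "[3]\<^sub>q = 1 + q + q ^ 2"

definition laurent_polys :: "ratfun set" where
  "laurent_polys = {to_fract p / q ^ n | p n. True}"

definition SL2_laurent :: "(ratfun ^ 2 ^ 2) set" where
  "SL2_laurent = {M. (\<forall>i j. M $ i $ j \<in> laurent_polys) \<and> det M = 1}"

definition A_q :: "ratfun ^ 2 ^ 2" where
  "A_q = vector [vector [q + 1, inverse q],
                 vector [1,     inverse q]]"

definition B_q :: "ratfun ^ 2 ^ 2" where
  "B_q = vector [vector [(q ^ 3 + q ^ 2 + 2 * q + 1) / q, (q + 1) / q ^ 2],
                 vector [(q + 1) / q,                     inverse (q ^ 2)]]"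

datatype letter = La | Lb

type_synonym ab_word = "letter list"

inductive_set christoffel_triples :: "(ab_word \<times> ab_word \<times> ab_word) set" where
  base: "([La], [La, Lb], [Lb]) \<in> christoffel_triples"
| left: "(w, w @ w', w') \<in> christoffel_triples \<Longrightarrow>
           (w, w @ w @ w', w @ w') \<in> christoffel_triples"
| right: "(w, w @ w', w') \<in> christoffel_triples \<Longrightarrow>
           (w @ w', w @ w' @ w', w') \<in> christoffel_triples"

fun eval_word :: "'r::semiring_1 ^ 'n ^ 'n \<Rightarrow> 'r ^ 'n ^ 'n \<Rightarrow> ab_word \<Rightarrow> 'r ^ 'n ^ 'n" where
  "eval_word A B [] = mat 1"
| "eval_word A B (La # w) = A ** eval_word A B w"
| "eval_word A B (Lb # w) = B ** eval_word A B w"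

end

theory Submission
  imports Defs
begin

text \<open>
  For \<open>M, N \<in> SL\<^sub>2\<close> the Cayley-Hamilton theorem gives \<open>tr (MMN) = tr M tr (MN) - tr N\<close>. After division
  of the traces by \<open>[3]\<^sub>q\<close>, passing to a child in the Christoffel tree is therefore the Vieta involution
  \<open>z \<mapsto> [3]\<^sub>q x y - z\<close> (or \<open>x \<mapsto> [3]\<^sub>q y z - x\<close>), which exchanges the two roots of the equation
  viewed as a quadratic in one unknown and preserves integrality.
\<close>

lemma laurent_polys_to_fract: "to_fract p \<in> laurent_polys"
  unfolding laurent_polys_def by (intro CollectI exI[of _ p] exI[of _ 0]) simp

lemma q_nonzero [simp]: "q \<noteq> 0"
  by (simp add: q_def)

lemma q3_nonzero [simp]: "[3]\<^sub>q \<noteq> 0"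
proof -
  have "[3]\<^sub>q = to_fract (1 + monom 1 1 + monom 1 1 ^ 2)"
    by (simp add: q3_def q_def power2_eq_square)
  \<comment> \<open>The value at 1 is 3, which rules out the zero polynomial.\<close>
  moreover have "poly (1 + monom 1 1 + monom 1 1 ^ 2 :: int poly) 1 \<noteq> 0"
    by (simp add: poly_monom)
  ultimately show ?thesis
    by (metis poly_0 to_fract_eq_0_iff)
qed

lemma to_fract_power: "to_fract (p ^ n) = to_fract p ^ n"
  by (induction n) simp_all

lemma laurent_polys_mult:
  assumes "x \<in> laurent_polys" "y \<in> laurent_polys"
  shows "x * y \<in> laurent_polys"
proof -
  obtain a m b n where "x = to_fract a / q ^ m" "y = to_fract b / q ^ n"
    using assms by (auto simp: laurent_polys_def)
  hence "x * y = to_fract (a * b) / q ^ (m + n)"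
    by (simp add: power_add)
  thus ?thesis unfolding laurent_polys_def by blast
qed

lemma laurent_polys_add:
  assumes "x \<in> laurent_polys" "y \<in> laurent_polys"
  shows "x + y \<in> laurent_polys"
proof -
  obtain a m b n where "x = to_fract a / q ^ m" "y = to_fract b / q ^ n"
    using assms by (auto simp: laurent_polys_def)
  moreover have "to_fract (a * monom 1 1 ^ n + b * monom 1 1 ^ m) = to_fract a * q ^ n + to_fract b * q ^ m"
    by (simp add: to_fract_power q_def)
  ultimately have "x + y = to_fract (a * monom 1 1 ^ n + b * monom 1 1 ^ m) / q ^ (m + n)"
    by (simp add: power_add add_divide_distrib)
  thus ?thesis unfolding laurent_polys_def by blast
qed

lemma laurent_polys_minus:
  assumes "x \<in> laurent_polys"
  shows "- x \<in> laurent_polys"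
  using laurent_polys_mult[OF laurent_polys_to_fract[of "- 1"] assms] by simp

lemma laurent_polys_diff:
  assumes "x \<in> laurent_polys" "y \<in> laurent_polys"
  shows "x - y \<in> laurent_polys"
  using laurent_polys_add[OF assms(1) laurent_polys_minus[OF assms(2)]] by simp

lemma laurent_polys_1: "1 \<in> laurent_polys"
  using laurent_polys_to_fract[of 1] by simp

lemma laurent_polys_power: "x \<in> laurent_polys \<Longrightarrow> x ^ n \<in> laurent_polys"
  by (induction n) (auto intro: laurent_polys_1 laurent_polys_mult)

lemma laurent_polys_q: "q \<in> laurent_polys"
  unfolding q_def by (rule laurent_polys_to_fract)

text \<open>Serves the coefficient 2 in the upper left entry of \<open>B_q\<close>.\<close>

lemma laurent_polys_numeral: "numeral k \<in> laurent_polys"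
  by (metis laurent_polys_to_fract of_nat_numeral of_nat_fract to_fract_def of_nat_poly)

lemma laurent_polys_divide_q: "x \<in> laurent_polys \<Longrightarrow> x / q ^ n \<in> laurent_polys"
proof -
  have "1 / q ^ n \<in> laurent_polys"
    unfolding laurent_polys_def by (intro CollectI exI[of _ 1] exI[of _ n]) simp
  then show "x \<in> laurent_polys \<Longrightarrow> x / q ^ n \<in> laurent_polys"
    using laurent_polys_mult[of x "1 / q ^ n"] by simp
qed

text \<open>The instance \<open>n = 1\<close> is listed separately because a goal
  \<open>x / q\<close> does not unify with \<open>x / q ^ n\<close>.\<close>

lemmas laurent_polys_intros =
  laurent_polys_1 laurent_polys_q laurent_polys_numeral laurent_polys_add laurent_polys_diff
  laurent_polys_mult laurent_polys_power laurent_polys_divide_q laurent_polys_divide_q[where n = 1, simplified]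

lemma laurent_polys_q3: "[3]\<^sub>q \<in> laurent_polys"
  unfolding q3_def by (intro laurent_polys_intros)

lemma A_q_in_SL2: "A_q \<in> SL2_laurent"
  unfolding SL2_laurent_def
  by (auto simp: A_q_def forall_2 det_2 inverse_eq_divide field_simps intro!: laurent_polys_intros)

lemma B_q_in_SL2: "B_q \<in> SL2_laurent"
proof -
  have "det B_q = 1"
    by (simp add: B_q_def det_2 field_simps) algebra
  moreover have "\<forall>i j. B_q $ i $ j \<in> laurent_polys"
    unfolding B_q_def forall_2 vector_2 inverse_eq_divide by (intro conjI laurent_polys_intros)
  ultimately show ?thesis by (simp add: SL2_laurent_def)
qed

lemma eval_word_append:
  "eval_word A B (u @ v) = eval_word A B u ** eval_word A B v"
  for A B :: "'r::semiring_1 ^ 'n ^ 'n"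
  by (induction A B u rule: eval_word.induct) (simp_all add: matrix_mul_assoc)

lemma det_eval_word:
  fixes A B :: "'r::comm_ring_1 ^ 'n ^ 'n"
  assumes "det A = 1" "det B = 1"
  shows "det (eval_word A B w) = 1"
  using assms by (induction A B w rule: eval_word.induct) (simp_all add: det_mul)

text \<open>Trace of M^2 = (trace M) M - (det M) I after multiplication by N. The bracketing, here
  and in the mirror version, is the one that \<open>eval_word_append\<close> produces for the
  children in the tree.\<close>

lemma trace_mul_mul_left_2:
  fixes M N :: "'r::comm_ring_1 ^ 2 ^ 2"
  shows "trace (M ** (M ** N)) = trace M * trace (M ** N) - det M * trace N"
  by (simp add: trace_def matrix_matrix_mult_def det_2 sum_2 algebra_simps)

lemma trace_mul_mul_right_2:
  fixes M N :: "'r::comm_ring_1 ^ 2 ^ 2"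
  shows "trace ((M ** N) ** N) = trace (M ** N) * trace N - det N * trace M"
  by (simp add: trace_def matrix_matrix_mult_def det_2 sum_2 algebra_simps)

text \<open>Integrality is bundled with the equation so that both descend the tree together: for a
  new entry it comes from the Vieta formula, with no division by \<open>[3]\<^sub>q\<close>.\<close>

definition q_markov :: "ratfun \<Rightarrow> ratfun \<Rightarrow> ratfun \<Rightarrow> bool" where
  "q_markov x y z \<longleftrightarrow> x \<in> laurent_polys \<and> y \<in> laurent_polys \<and> z \<in> laurent_polys \<and>
     x ^ 2 + y ^ 2 + z ^ 2 + (q - 1) ^ 2 / q ^ 3 = [3]\<^sub>q * x * y * z"

text \<open>With z' = \<open>[3]\<^sub>q * x * y - z\<close>, both z^2 - \<open>[3]\<^sub>q\<close>
  x y z and its analogue for z' equal -z z'. The new entry takes the middle place, as the longest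
  word does in a child triple.\<close>

lemma q_markov_left: "q_markov x y z \<Longrightarrow> q_markov x ([3]\<^sub>q * x * y - z) y"
  unfolding q_markov_def
  by (auto intro!: laurent_polys_intros laurent_polys_q3 simp: power2_eq_square algebra_simps)

lemma q_markov_right: "q_markov x y z \<Longrightarrow> q_markov y ([3]\<^sub>q * y * z - x) z"
  unfolding q_markov_def
  by (auto intro!: laurent_polys_intros laurent_polys_q3 simp: power2_eq_square algebra_simps)

text \<open>The root triple, from the traces of \<open>A_q\<close>, \<open>A_q ** B_q\<close> and
  \<open>B_q\<close>. At q = 1 it becomes the Markov triple (1, 5, 2).\<close>

lemma q_markov_base:
  "q_markov (1 / q) ((q ^ 4 + q ^ 3 + q ^ 2 + q + 1) / q ^ 3) ((q ^ 2 + 1) / q ^ 2)"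
proof -
  have "(1 / q) ^ 2 + ((q ^ 4 + q ^ 3 + q ^ 2 + q + 1) / q ^ 3) ^ 2 + ((q ^ 2 + 1) / q ^ 2) ^ 2
      + (q - 1) ^ 2 / q ^ 3
    = [3]\<^sub>q * (1 / q) * ((q ^ 4 + q ^ 3 + q ^ 2 + q + 1) / q ^ 3) * ((q ^ 2 + 1) / q ^ 2)"
    by (simp add: q3_def field_simps) algebra
  then show ?thesis
    unfolding q_markov_def by (intro conjI laurent_polys_intros)
qed

lemma trace_A_q: "trace A_q / [3]\<^sub>q = 1 / q"
proof -
  \<comment> \<open>With the factor \<open>[3]\<^sub>q\<close> displayed, the quotient is a plain
    cancellation.\<close>
  have "trace A_q = [3]\<^sub>q * (1 / q)"
    by (simp add: A_q_def trace_def sum_2 q3_def field_simps power2_eq_square)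
  then show ?thesis by simp
qed

lemma trace_B_q: "trace B_q / [3]\<^sub>q = (q ^ 2 + 1) / q ^ 2"
proof -
  have "trace B_q = [3]\<^sub>q * ((q ^ 2 + 1) / q ^ 2)"
    by (simp add: B_q_def trace_def sum_2 q3_def field_simps) algebra
  then show ?thesis by simp
qed

lemma trace_A_q_B_q: "trace (A_q ** B_q) / [3]\<^sub>q = (q ^ 4 + q ^ 3 + q ^ 2 + q + 1) / q ^ 3"
proof -
  have "trace (A_q ** B_q) = [3]\<^sub>q * ((q ^ 4 + q ^ 3 + q ^ 2 + q + 1) / q ^ 3)"
    by (simp add: A_q_def B_q_def matrix_matrix_mult_def trace_def sum_2 q3_def field_simps) algebra
  then show ?thesis by simp
qed

lemma q_markov_christoffel:
  assumes "(w, v, w') \<in> christoffel_triples"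
  shows "q_markov (trace (eval_word A_q B_q w) / [3]\<^sub>q)
    (trace (eval_word A_q B_q w ** eval_word A_q B_q w') / [3]\<^sub>q)
    (trace (eval_word A_q B_q w') / [3]\<^sub>q)"
  using assms
proof (induction w v w' rule: christoffel_triples.induct)
  case base
  show ?case
    using q_markov_base by (simp add: trace_A_q trace_B_q trace_A_q_B_q)
next
  case (left w w')
  let ?M = "eval_word A_q B_q w" and ?N = "eval_word A_q B_q w'"
  have "det ?M = 1"
    using A_q_in_SL2 B_q_in_SL2 by (intro det_eval_word) (auto simp: SL2_laurent_def)
  \<comment> \<open>The child has outer words \<open>w\<close> and \<open>w @ w'\<close>, so its
    middle entry is this trace. Each of the two traces in the product carries its own denominator,
    hence the factor \<open>[3]\<^sub>q\<close> in front.\<close>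
  then have "trace (?M ** (?M ** ?N)) / [3]\<^sub>q
      = [3]\<^sub>q * (trace ?M / [3]\<^sub>q) * (trace (?M ** ?N) / [3]\<^sub>q) - trace ?N / [3]\<^sub>q"
    by (simp add: trace_mul_mul_left_2 diff_divide_distrib)
  then show ?case
    using q_markov_left[OF left.IH] by (simp add: eval_word_append)
next
  case (right w w')
  let ?M = "eval_word A_q B_q w" and ?N = "eval_word A_q B_q w'"
  have "det ?N = 1"
    using A_q_in_SL2 B_q_in_SL2 by (intro det_eval_word) (auto simp: SL2_laurent_def)
  \<comment> \<open>Now \<open>w'\<close> is the word kept, so the determinant of \<open>?N\<close>
    enters and the entry of \<open>w\<close> is replaced.\<close>
  then have "trace ((?M ** ?N) ** ?N) / [3]\<^sub>q
      = [3]\<^sub>q * (trace (?M ** ?N) / [3]\<^sub>q) * (trace ?N / [3]\<^sub>q) - trace ?M / [3]\<^sub>q"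
    by (simp add: trace_mul_mul_right_2 diff_divide_distrib)
  then show ?case
    using q_markov_right[OF right.IH] by (simp add: eval_word_append)
qed

theorem theorem2p4:
  "A_q \<in> SL2_laurent \<and> B_q \<in> SL2_laurent \<and>
   (\<forall>w w' :: ab_word. (w, w @ w', w') \<in> christoffel_triples \<longrightarrow>
     (let x = trace (eval_word A_q B_q w) / [3]\<^sub>q;
          y = trace (eval_word A_q B_q w ** eval_word A_q B_q w') / [3]\<^sub>q;
          z = trace (eval_word A_q B_q w') / [3]\<^sub>q
      in x \<in> laurent_polys \<and> y \<in> laurent_polys \<and> z \<in> laurent_polys \<and>
         x ^ 2 + y ^ 2 + z ^ 2 + (q - 1) ^ 2 / q ^ 3 = [3]\<^sub>q * x * y * z))"
  using A_q_in_SL2 B_q_in_SL2 q_markov_christoffel unfolding q_markov_def Let_def by blast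

end
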